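(* Every Gurariy space has the Daugavet property, and hence the strong diameter 2 property.
   Context: All Banach spaces are real. A Banach space $X$ is a Gurariy space if whenever $\varepsilon>0$, $E$ is a finite-dimensional Banach space, $T_E:E\to X$ is a linear isometry (into), and $F$ is a finite-dimensional Banach space with $E\subset F$ (isometrically, as a subspace), there exists a linear operator $T_F:F\to X$ such that $T_F(f)=T_E(f)$ for all $f\in E$ and $(1+\varepsilon)^{-1}\|f\|\le\|T_Ff\|\le(1+\varepsilon)\|f\|$ for all $f\in F$. A Banach space $X$ has the Daugavet property if $\|I+T\|=1+\|T\|$ for every bounded linear rank 1 operator $T:X\to X$, where $I$ is the identity operator on $X$. A slice of the closed unit ball $B_X$ is a set $S(x^{*},\varepsilon)=\{x\in B_X: x^{*}(x)>1-\varepsilon\}$, where $x^{*}\in X^{*}$, $\|x^{*}\|=1$ and $\varepsilon>0$. A finite convex combination of slices of $B_X$ is a set of the form $\sum_{i=1}^{n}\lambda_i S(x_i^{*},\varepsilon_i)$ (Minkowski sum) with $\lambda_i\ge 0$, $\sum_{i=1}^{n}\lambda_i=1$, $\|x_i^{*}\|=1$ and $\varepsilon_i>0$. $X$ has the strong diameter 2 property if every finite convex combination of slices of $B_X$ has diameter 2. *)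

theory Defs
  imports "HOL-Analysis.Analysis" "HOL-Analysis.Finite_Function_Topology"
begin

definition linear_map_on :: "'v::real_vector set \<Rightarrow> ('v \<Rightarrow> 'w::real_vector) \<Rightarrow> bool" where
  "linear_map_on V T \<longleftrightarrow>
     (\<forall>x\<in>V. \<forall>y\<in>V. T (x + y) = T x + T y) \<and> (\<forall>c. \<forall>x\<in>V. T (c *\<^sub>R x) = c *\<^sub>R T x)"

definition norm_on :: "'v::real_vector set \<Rightarrow> ('v \<Rightarrow> real) \<Rightarrow> bool" where
  "norm_on V N \<longleftrightarrow>
     (\<forall>x\<in>V. 0 \<le> N x \<and> (N x = 0 \<longleftrightarrow> x = 0)) \<and>
     (\<forall>c. \<forall>x\<in>V. N (c *\<^sub>R x) = \<bar>c\<bar> * N x) \<and>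
     (\<forall>x\<in>V. \<forall>y\<in>V. N (x + y) \<le> N x + N y)"

text \<open>A finite-dimensional normed space, given as a carrier \<open>V\<close> with a norm \<open>N\<close> on it.
  Completeness is automatic in finite dimension.\<close>

definition findim_normed_space :: "'v::real_vector set \<Rightarrow> ('v \<Rightarrow> real) \<Rightarrow> bool" where
  "findim_normed_space V N \<longleftrightarrow> (\<exists>B. finite B \<and> V = span B) \<and> norm_on V N"

text \<open>HOL cannot quantify over types inside a formula, so ``every finite-dimensional Banach space
  \<open>F\<close>'' is rendered as every finite-dimensional subspace of the space \<open>nat \<Rightarrow>\<^sub>0 real\<close> of
  finitely supported sequences, with an arbitrary norm \<open>N\<close> on that subspace (unrelated to any
  topology of the ambient type). Up to isometry these are all the finite-dimensional
  real Banach spaces; \<open>gurariy_space_extend\<close> below recovers the extension property for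
  finite-dimensional subspaces of arbitrary normed spaces.\<close>

definition gurariy_space :: "'a::banach itself \<Rightarrow> bool" where
  "gurariy_space _ \<longleftrightarrow>
     (\<forall>\<epsilon>>0. \<forall>(E :: (nat \<Rightarrow>\<^sub>0 real) set) (F :: (nat \<Rightarrow>\<^sub>0 real) set) N (T\<^sub>E :: (nat \<Rightarrow>\<^sub>0 real) \<Rightarrow> 'a).
        findim_normed_space F N \<and> subspace E \<and> E \<subseteq> F \<and>
        linear_map_on E T\<^sub>E \<and> (\<forall>e\<in>E. norm (T\<^sub>E e) = N e) \<longrightarrow>
        (\<exists>T\<^sub>F :: (nat \<Rightarrow>\<^sub>0 real) \<Rightarrow> 'a.
           linear_map_on F T\<^sub>F \<and> (\<forall>f\<in>E. T\<^sub>F f = T\<^sub>E f) \<and>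
           (\<forall>f\<in>F. inverse (1 + \<epsilon>) * N f \<le> norm (T\<^sub>F f) \<and> norm (T\<^sub>F f) \<le> (1 + \<epsilon>) * N f)))"

text \<open>\<open>dim\<close> is \<open>0\<close> on infinite-dimensional spans, so \<open>dim = 1\<close> says exactly rank one.\<close>

definition daugavet_property :: "'a::banach itself \<Rightarrow> bool" where
  "daugavet_property _ \<longleftrightarrow>
     (\<forall>T :: 'a \<Rightarrow>\<^sub>L 'a. dim (range (blinfun_apply T)) = 1 \<longrightarrow> norm (id_blinfun + T) = 1 + norm T)"

definition slice :: "('a::real_normed_vector \<Rightarrow>\<^sub>L real) \<Rightarrow> real \<Rightarrow> 'a set" where
  "slice f \<epsilon> = {x \<in> cball 0 1. blinfun_apply f x > 1 - \<epsilon>}"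

definition convex_comb_of_slices :: "'a::real_normed_vector set \<Rightarrow> bool" where
  "convex_comb_of_slices C \<longleftrightarrow>
     (\<exists>(n::nat) (l :: nat \<Rightarrow> real) (f :: nat \<Rightarrow> 'a \<Rightarrow>\<^sub>L real) (\<epsilon> :: nat \<Rightarrow> real).
        (\<forall>i<n. 0 \<le> l i \<and> norm (f i) = 1 \<and> 0 < \<epsilon> i) \<and> (\<Sum>i<n. l i) = 1 \<and>
        C = {\<Sum>i<n. l i *\<^sub>R x i | x. \<forall>i<n. x i \<in> slice (f i) (\<epsilon> i)})"

definition strong_diameter_2_property :: "'a::banach itself \<Rightarrow> bool" where
  "strong_diameter_2_property _ \<longleftrightarrow> (\<forall>C :: 'a set. convex_comb_of_slices C \<longrightarrow> diameter C = 2)"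

lemma independent_single:
  "independent (range (\<lambda>i::nat. Poly_Mapping.single i (1::real)))"
proof -
  have lookup_scaleR: "Poly_Mapping.lookup (c *\<^sub>R p) i = c * Poly_Mapping.lookup p i"
    for c i and p :: "nat \<Rightarrow>\<^sub>0 real"
  proof -
    have "finite {i. c * Poly_Mapping.lookup p i \<noteq> 0}"
      by (rule finite_subset[OF _ finite_lookup[of p]]) auto
    then show ?thesis by (simp add: scaleR_poly_mapping_def)
  qed
  have "u v = 0"
    if fin: "finite S" and S: "S \<subseteq> range (\<lambda>i::nat. Poly_Mapping.single i (1::real))"
      and 0: "(\<Sum>v\<in>S. u v *\<^sub>R v) = 0" and v: "v \<in> S" for S u v
  proof -
    obtain i where i: "v = Poly_Mapping.single i 1" using v S by auto
    have lsum: "Poly_Mapping.lookup (\<Sum>w\<in>S. u w *\<^sub>R w) i = (\<Sum>w\<in>S. Poly_Mapping.lookup (u w *\<^sub>R w) i)"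
      using fin by (induction S rule: finite_induct) (auto simp: lookup_add)
    have other: "Poly_Mapping.lookup (u w *\<^sub>R w) i = 0" if w: "w \<in> S - {v}" for w
    proof -
      obtain j where "w = Poly_Mapping.single j 1" using w S by auto
      with w i show ?thesis by (auto simp: lookup_scaleR lookup_single when_def)
    qed
    have "(\<Sum>w\<in>S. Poly_Mapping.lookup (u w *\<^sub>R w) i) = Poly_Mapping.lookup (u v *\<^sub>R v) i"
      using fin v other by (subst sum.remove[of S v]) auto
    with lsum 0 i show ?thesis by (simp add: lookup_scaleR lookup_single)
  qed
  then show ?thesis unfolding independent_explicit_finite_subsets by blast
qed

lemma gurariy_space_extend:
  fixes E F :: "'f::real_normed_vector set" and T :: "'f \<Rightarrow> 'a::banach"
  assumes G: "gurariy_space TYPE('a)" and "\<epsilon> > 0"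
    and F: "finite B" "F = span B" and E: "subspace E" "E \<subseteq> F"
    and T: "linear_map_on E T" "\<And>e. e \<in> E \<Longrightarrow> norm (T e) = norm e"
  shows "\<exists>S. linear_map_on F S \<and> (\<forall>f\<in>E. S f = T f) \<and>
           (\<forall>f\<in>F. inverse (1 + \<epsilon>) * norm f \<le> norm (S f) \<and> norm (S f) \<le> (1 + \<epsilon>) * norm f)"
proof -
  obtain B' where B'0: "B' \<subseteq> B" "independent B'" "B \<subseteq> span B'"
    using maximal_independent_subset[of B] by blast
  have "span B' = F"
    unfolding F(2) using B'0 by (intro subset_antisym span_mono span_minimal) auto
  with B'0 have B': "B' \<subseteq> B" "independent B'" "span B' = F" by auto
  have "finite B'" using B' F finite_subset by blast
  then obtain h :: "'f \<Rightarrow> nat" where h: "inj_on h B'"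
    using finite_imp_inj_to_nat_seg by blast
  define s where "s = (\<lambda>i::nat. Poly_Mapping.single i (1::real))"
  have inj_s: "inj s"
    unfolding s_def by (auto simp: inj_on_def dest: arg_cong[where f = Poly_Mapping.keys])
  define C where "C = (\<lambda>b. s (h b)) ` B'"
  have injC: "inj_on (\<lambda>b. s (h b)) B'" using h inj_s by (auto simp: inj_on_def)
  have indC: "independent C"
    using independent_single by (rule independent_mono) (auto simp: C_def s_def)
  obtain \<phi> where \<phi>: "linear \<phi>" "\<And>b. b \<in> B' \<Longrightarrow> \<phi> b = s (h b)"
    using linear_independent_extend[OF B'(2), of "\<lambda>b. s (h b)"] by blast
  obtain \<psi> where \<psi>: "linear \<psi>" "\<And>c. c \<in> C \<Longrightarrow> \<psi> c = the_inv_into B' (\<lambda>b. s (h b)) c"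
    using linear_independent_extend[OF indC, of "the_inv_into B' (\<lambda>b. s (h b))"] by blast
  have \<psi>s: "\<psi> (s (h b)) = b" if "b \<in> B'" for b
    using that \<psi>(2)[of "s (h b)"] the_inv_into_f_f[OF injC] by (auto simp: C_def)
  define V where "V = span C"
  have C\<phi>: "C = \<phi> ` B'" using \<phi>(2) by (auto simp: C_def)
  have V\<phi>: "V = \<phi> ` F" unfolding V_def C\<phi> B'(3)[symmetric]
    using linear_span_image[OF \<phi>(1)] by blast
  have \<psi>\<phi>: "\<psi> (\<phi> x) = x" if "x \<in> F" for x
    using linear_eq_on[OF linear_compose[OF \<phi>(1) \<psi>(1)] linear_id, of x B'] that B'(3) \<psi>s \<phi>(2)
    by (auto simp: o_def)
  have sF: "subspace F" using F by simp
  have V\<psi>: "\<psi> v \<in> F" "\<phi> (\<psi> v) = v" if "v \<in> V" for v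
    using that \<psi>\<phi> by (auto simp: V\<phi>)
  have \<psi>0: "\<psi> v = 0 \<longleftrightarrow> v = 0" if "v \<in> V" for v
    using V\<psi>(2)[OF that] linear_0[OF \<phi>(1)] linear_0[OF \<psi>(1)] by auto
  have fd: "findim_normed_space V (\<lambda>v. norm (\<psi> v))"
    unfolding findim_normed_space_def norm_on_def
    using \<open>finite B'\<close> \<psi>0
    by (auto simp: V_def C_def linear_add[OF \<psi>(1)] linear_scale[OF \<psi>(1)] norm_triangle_ineq
        intro!: exI[of _ "(\<lambda>b. s (h b)) ` B'"])
  have sub: "subspace (\<phi> ` E)" "\<phi> ` E \<subseteq> V"
    using E linear_subspace_image[OF \<phi>(1)] by (auto simp: V\<phi>)
  have "linear_map_on (\<phi> ` E) (\<lambda>v. T (\<psi> v))" "\<forall>v\<in>\<phi> ` E. norm (T (\<psi> v)) = norm (\<psi> v)"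
    using T E \<psi>\<phi> unfolding linear_map_on_def
    by (auto simp: linear_add[OF \<psi>(1)] linear_scale[OF \<psi>(1)] subset_iff)
  with G[unfolded gurariy_space_def, rule_format, OF \<open>\<epsilon> > 0\<close>,
      of V "\<lambda>v. norm (\<psi> v)" "\<phi> ` E" "\<lambda>v. T (\<psi> v)"] fd sub
  obtain S where S: "linear_map_on V S" "\<forall>v\<in>\<phi> ` E. S v = T (\<psi> v)"
      "\<forall>v\<in>V. inverse (1 + \<epsilon>) * norm (\<psi> v) \<le> norm (S v) \<and> norm (S v) \<le> (1 + \<epsilon>) * norm (\<psi> v)"
    by blast
  have "linear_map_on F (\<lambda>x. S (\<phi> x))"
    using S(1) unfolding linear_map_on_def V\<phi>
    by (auto simp: linear_add[OF \<phi>(1)] linear_scale[OF \<phi>(1)])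
  with S(2,3) show ?thesis
    using E \<psi>\<phi> by (intro exI[of _ "\<lambda>x. S (\<phi> x)"]) (auto simp: V\<phi> subset_iff)
qed

end

theory Submission
  imports Defs
begin

text \<open>
  The proof places vectors in a prescribed slice that are almost orthogonal, in the \<open>\<ell>\<^sub>1\<close> sense,
  to a prescribed unit vector \<open>x\<close>: in a Gurariy space every slice contains a \<open>y\<close> with
  \<open>\<parallel>x + y\<parallel> > 2 - \<epsilon>\<close> (\<open>gurariy_slice_far_point\<close>).

  Take any \<open>y\<^sub>0\<close> well inside the slice and embed \<open>span {x, y\<^sub>0}\<close> as the constant sequences in
  the space of bounded sequences of vectors. For \<open>i < n\<close> let \<open>y\<^sub>i\<close> be the constant sequence
  \<open>y\<^sub>0\<close> with its entry \<open>i\<close> replaced by \<open>x\<close>. Then \<open>\<parallel>y\<^sub>i\<parallel> \<le> 1\<close>, and \<open>\<parallel>x + y\<^sub>i\<parallel> \<ge> 2\<close> because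
  of entry \<open>i\<close>, while the average of the \<open>y\<^sub>i\<close> differs from \<open>y\<^sub>0\<close> by at most \<open>2/n\<close> in norm.
  The Gurariy property maps all these sequences almost isometrically back into the space
  and returns \<open>x\<close> and \<open>y\<^sub>0\<close> to themselves. The images of the \<open>y\<^sub>i\<close> then have an average close
  to \<open>y\<^sub>0\<close>, so a functional large at \<open>y\<^sub>0\<close> is large at one of them.

  By homogeneity this gives \<open>\<parallel>v + r y\<parallel> \<ge> \<parallel>v\<parallel> + r - \<epsilon>\<close> for a suitable \<open>y\<close> in any given slice,
  whatever \<open>v\<close> and \<open>r \<ge> 0\<close> are (\<open>slices_l1_orthogonal\<close>), and both conclusions follow from
  that alone. For the operator \<open>f \<otimes> u\<close> with \<open>\<parallel>f\<parallel> = 1\<close>, a \<open>y\<close> with \<open>f y\<close> almost \<open>1\<close> that is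
  almost orthogonal to \<open>u\<close> satisfies \<open>\<parallel>y + f y u\<parallel> \<approx> 1 + \<parallel>u\<parallel>\<close>. For convex combinations of
  slices, the points are chosen one after the other, each almost orthogonal to the partial
  sum so far, first in the given slices and then in their reflections at the origin.
\<close>

section \<open>Slices of the unit ball\<close>

lemma slice_nonempty:
  fixes f :: "'a::real_normed_vector \<Rightarrow>\<^sub>L real"
  assumes f: "norm f = 1" and e: "\<epsilon> > 0"
  shows "slice f \<epsilon> \<noteq> {}"
proof -
  define b where "b = max 0 (1 - \<epsilon>)"
  have "\<not> (\<forall>z. norm (f z) \<le> b * norm z)"
  proof
    assume "\<forall>z. norm (f z) \<le> b * norm z"
    then have "norm f \<le> b" by (intro norm_blinfun_bound) (auto simp: b_def)
    then show False using f e by (auto simp: b_def)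
  qed
  then obtain z where z: "b * norm z < \<bar>f z\<bar>" by (auto simp: not_le)
  then have z0: "norm z > 0" by auto
  define y where "y = (sgn (f z) / norm z) *\<^sub>R z"
  have "norm y \<le> 1"
    using z0 by (auto simp: y_def abs_sgn_eq)
  moreover have "f y = \<bar>f z\<bar> / norm z"
    by (simp add: y_def blinfun.scaleR_right sgn_mult_self_eq abs_sgn mult.commute)
  then have "f y > b" using z z0 by (simp add: pos_less_divide_eq)
  then have "f y > 1 - \<epsilon>" by (auto simp: b_def)
  ultimately show ?thesis by (auto simp: slice_def)
qed

lemma slice_mono: "\<epsilon> \<le> \<delta> \<Longrightarrow> slice f \<epsilon> \<subseteq> slice f \<delta>"
  by (auto simp: slice_def)

section \<open>Far points of slices in a Gurariy space\<close>

definition entry_bcontfun :: "nat \<Rightarrow> 'a::real_normed_vector \<Rightarrow> nat \<Rightarrow>\<^sub>C 'a" where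
  "entry_bcontfun i w = Bcontfun (\<lambda>k. if k = i then w else 0)"

lemma apply_entry_bcontfun [simp]:
  "apply_bcontfun (entry_bcontfun i w) k = (if k = i then w else 0)"
proof -
  have "(\<lambda>k. if k = i then w else 0) \<in> bcontfun"
    by (rule bcontfun_normI[where b = "norm w"]) auto
  then show ?thesis by (simp add: entry_bcontfun_def Bcontfun_inverse)
qed

lemma apply_bcontfun_sum:
  "apply_bcontfun (\<Sum>i\<in>A. g i) k = (\<Sum>i\<in>A. apply_bcontfun (g i) k)"
  by (induction A rule: infinite_finite_induct) auto

lemma linear_map_on_sum:
  assumes S: "linear_map_on V S" and V: "subspace V" and g: "\<And>i. i \<in> A \<Longrightarrow> g i \<in> V"
  shows "S (\<Sum>i\<in>A. g i) = (\<Sum>i\<in>A. S (g i))"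
proof -
  have S0: "S 0 = 0"
    using S subspace_0[OF V] unfolding linear_map_on_def by (metis scaleR_zero_left)
  show ?thesis using g
  proof (induction A rule: infinite_finite_induct)
    case (insert i A)
    then show ?case
      using S subspace_sum[OF V, of A g] by (simp add: linear_map_on_def)
  qed (use S0 in auto)
qed

text \<open>The sup norm on sequences keeps the entries from interacting: the sum of all corrections
  \<open>d\<^sub>i\<close>, which put \<open>x - y\<^sub>0\<close> at entry \<open>i\<close>, is no longer than a single one of them. So the
  functional cannot be very negative on the images of all of the \<open>d\<^sub>i\<close>, and for some \<open>i\<close> the
  correction hardly lowers its value.\<close>

lemma gurariy_slice_far_point:
  fixes f :: "'a::banach \<Rightarrow>\<^sub>L real" and x :: 'a
  assumes G: "gurariy_space TYPE('a)"
    and f: "norm f = 1" and x: "norm x = 1" and e: "\<epsilon> > 0"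
  obtains y where "y \<in> slice f \<epsilon>" "norm (x + y) > 2 - \<epsilon>"
proof -
  obtain y0 where y0: "norm y0 \<le> 1" "f y0 > 1 - \<epsilon> / 4"
    using slice_nonempty[OF f, of "\<epsilon> / 4"] e by (auto simp: slice_def)
  define \<delta> where "\<delta> = min 1 (\<epsilon> / 4)"
  have \<delta>: "0 < \<delta>" "\<delta> \<le> 1" "\<delta> \<le> \<epsilon> / 4" using e by (auto simp: \<delta>_def)
  obtain n :: nat where n: "16 / \<epsilon> < real n" using reals_Archimedean2 by blast
  then have n0: "real n > 0" using e by (smt (verit) divide_pos_pos)
  define c :: "'a \<Rightarrow> nat \<Rightarrow>\<^sub>C 'a" where "c = const_bcontfun"
  have c: "apply_bcontfun (c v) k = v" for v k by (simp add: c_def const_bcontfun.rep_eq)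
  define d where "d = (\<lambda>i. entry_bcontfun i (x - y0))"
  define E where "E = span {c x, c y0}"
  define B where "B = {c x, c y0} \<union> d ` {..<n}"
  have E0: "subspace E" "E \<subseteq> span B"
    unfolding E_def B_def by (simp, intro span_mono Un_upper1)
  have inB: "c x \<in> span B" "c y0 \<in> span B" "\<And>i. i < n \<Longrightarrow> d i \<in> span B"
    by (auto simp: B_def intro: span_base)
  have const: "g = c (apply_bcontfun g 0)" if "g \<in> E" for g
  proof -
    have "linear (\<lambda>g. c (apply_bcontfun g 0))"
      by (rule linearI) (auto intro!: bcontfun_eqI simp: c)
    then have "c (apply_bcontfun g 0) = id g"
      using that unfolding E_def
      by (rule linear_eq_on[OF _ linear_id]) (auto simp: c)
    then show ?thesis by simp
  qed
  have norm_c: "norm (c v) = norm v" for v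
    by (intro antisym norm_bound, simp add: c) (metis c norm_bounded)
  \<comment> \<open>On the constant sequences, evaluation at entry \<open>0\<close> is the canonical isometry.\<close>
  have T: "linear_map_on E (\<lambda>g. apply_bcontfun g 0)"
      "\<And>g. g \<in> E \<Longrightarrow> norm (apply_bcontfun g 0) = norm g"
    by (simp add: linear_map_on_def, metis const norm_c)
  obtain S where S: "linear_map_on (span B) S"
      "\<And>g. g \<in> E \<Longrightarrow> S g = apply_bcontfun g 0"
      "\<And>g. g \<in> span B \<Longrightarrow> inverse (1 + \<delta>) * norm g \<le> norm (S g)"
      "\<And>g. g \<in> span B \<Longrightarrow> norm (S g) \<le> (1 + \<delta>) * norm g"
    using gurariy_space_extend[OF G \<delta>(1) _ refl E0 T] by (auto simp: B_def)
  have Sadd: "S (g + h) = S g + S h" if "g \<in> span B" "h \<in> span B" for g h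
    using S(1) that by (simp add: linear_map_on_def)
  have Sc: "S (c x) = x" "S (c y0) = y0"
    using S(2)[of "c x"] S(2)[of "c y0"] by (simp_all add: E_def c span_base)
  have xy0: "norm (x - y0) \<le> 2" using norm_triangle_ineq4[of x y0] x y0 by simp
  have "norm (\<Sum>i<n. d i) \<le> 2"
  proof (rule norm_bound)
    fix k
    have "apply_bcontfun (\<Sum>i<n. d i) k = (if k < n then x - y0 else 0)"
      by (simp add: apply_bcontfun_sum d_def)
    then show "norm (apply_bcontfun (\<Sum>i<n. d i) k) \<le> 2" using xy0 by simp
  qed
  then have "(1 + \<delta>) * norm (\<Sum>i<n. d i) \<le> 2 * 2"
    using \<delta> by (intro mult_mono) auto
  moreover have sum_in: "(\<Sum>i<n. d i) \<in> span B"
    using inB(3) by (intro span_sum) auto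
  ultimately have "norm (S (\<Sum>i<n. d i)) \<le> 4" using S(4)[of "\<Sum>i<n. d i"] by simp
  moreover have "\<bar>f (S (\<Sum>i<n. d i))\<bar> \<le> norm (S (\<Sum>i<n. d i))"
    using norm_blinfun[of f "S (\<Sum>i<n. d i)"] f by simp
  ultimately have "- 4 \<le> f (S (\<Sum>i<n. d i))" by linarith
  also have "\<dots> = (\<Sum>i<n. f (S (d i)))"
    using inB(3) by (subst linear_map_on_sum[OF S(1)]) (auto simp: blinfun.sum_right)
  finally have fsum: "- 4 \<le> (\<Sum>i<n. f (S (d i)))" .
  have "\<exists>i<n. - (4 / real n) \<le> f (S (d i))"
  proof (rule ccontr)
    assume "\<not> ?thesis"
    then have "(\<Sum>i<n. f (S (d i))) < (\<Sum>i<n. - (4 / real n))"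
      using n0 by (intro sum_strict_mono) (auto simp: not_le)
    also have "\<dots> = - 4" using n0 by simp
    finally show False using fsum by simp
  qed
  then obtain i where i: "i < n" "- (4 / real n) \<le> f (S (d i))" by blast
  define g where "g = c y0 + d i"
  have gB: "g \<in> span B" using inB i by (auto simp: g_def intro: span_add)
  have "norm g \<le> 1"
    using x y0 by (intro norm_bound) (auto simp: g_def d_def c)
  then have "(1 + \<delta>) * norm g \<le> (1 + \<delta>) * 1" using \<delta> by (intro mult_left_mono) auto
  then have Sg: "norm (S g) \<le> 1 + \<delta>" using S(4)[OF gB] by simp
  have "norm (apply_bcontfun (c x + g) i) \<le> norm (c x + g)" by (rule norm_bounded)
  moreover have "apply_bcontfun (c x + g) i = 2 *\<^sub>R x"
    by (simp add: g_def d_def c scaleR_2)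
  ultimately have "2 \<le> norm (c x + g)" using x by simp
  then have "inverse (1 + \<delta>) * 2 \<le> inverse (1 + \<delta>) * norm (c x + g)"
    using \<delta> by (intro mult_left_mono) auto
  also have "\<dots> \<le> norm (S (c x + g))" using inB gB by (intro S(3) span_add)
  also have "S (c x + g) = x + S g" using Sadd inB gB Sc by simp
  finally have far: "inverse (1 + \<delta>) * 2 \<le> norm (x + S g)" .
  have "4 / real n < \<epsilon> / 4" using n n0 e by (simp add: field_simps)
  then have fg: "f (S g) > 1 - \<epsilon> / 2"
    using i y0 Sadd[OF inB(2) inB(3)[OF i(1)]] Sc by (simp add: g_def blinfun.add_right)
  \<comment> \<open>\<open>S g\<close> may leave the unit ball by \<open>\<delta>\<close>; the scaling back into it moves the point by at
    most \<open>\<delta>\<close>.\<close>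
  define y where "y = S g /\<^sub>R (1 + \<delta>)"
  have "norm y \<le> 1" using Sg \<delta> by (simp add: y_def field_simps)
  moreover have "f y > 1 - \<epsilon>"
  proof -
    have "(1 - \<epsilon>) * (1 + \<delta>) = 1 - \<epsilon> + \<delta> - \<epsilon> * \<delta>" by (simp add: algebra_simps)
    also have "\<dots> \<le> 1 - \<epsilon> / 2" using \<delta> e mult_pos_pos[OF e \<delta>(1)] by linarith
    finally have "(1 - \<epsilon>) * (1 + \<delta>) < f (S g)" using fg by simp
    then show ?thesis using \<delta> by (simp add: y_def blinfun.scaleR_right field_simps)
  qed
  moreover have "norm (x + y) > 2 - \<epsilon>"
  proof -
    have "S g = (1 + \<delta>) *\<^sub>R y" using \<delta> by (simp add: y_def)
    then have "x + S g = (x + y) + \<delta> *\<^sub>R y" by (simp add: algebra_simps)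
    then have "norm (x + S g) \<le> norm (x + y) + \<delta> * norm y"
      using norm_triangle_ineq[of "x + y" "\<delta> *\<^sub>R y"] \<delta> by (simp add: add.assoc)
    moreover have "\<delta> * norm y \<le> \<delta>" using \<open>norm y \<le> 1\<close> \<delta> by (simp add: mult_left_le)
    moreover have "1 - \<delta> \<le> inverse (1 + \<delta>)"
    proof -
      have "(1 - \<delta>) * (1 + \<delta>) \<le> 1" by (simp add: algebra_simps)
      then show ?thesis using \<delta> by (simp add: field_simps)
    qed
    ultimately show ?thesis using far \<delta> by linarith
  qed
  ultimately show ?thesis using that[of y] by (auto simp: slice_def)
qed

section \<open>Almost \<open>\<ell>\<^sub>1\<close>-orthogonal points in slices\<close>

text \<open>By a theorem of Kadets, Shvidkoy, Sirotkin and Werner this condition is equivalent to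
  the Daugavet property. Allowing a vector \<open>v\<close> and a factor \<open>r\<close> of any length makes it
  directly applicable to the partial sums of a convex combination.\<close>

definition slices_l1_orthogonal :: "'a::banach itself \<Rightarrow> bool" where
  "slices_l1_orthogonal _ \<longleftrightarrow>
     (\<forall>(f :: 'a \<Rightarrow>\<^sub>L real) \<epsilon> v r. norm f = 1 \<longrightarrow> 0 < \<epsilon> \<longrightarrow> 0 \<le> r \<longrightarrow>
        (\<exists>y\<in>slice f \<epsilon>. norm v + r - \<epsilon> \<le> norm (v + r *\<^sub>R y)))"

text \<open>If \<open>\<parallel>x + y\<parallel>\<close> is almost \<open>2\<close> then the triangle inequality is almost an equality for all
  nonnegative combinations \<open>s x + r y\<close>: the larger coefficient is split into the smaller one
  and a remainder, and the defect is multiplied by the larger one.\<close>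

lemma norm_add_scaled_ge:
  fixes x y :: "'a::real_normed_vector"
  assumes x: "norm x \<le> 1" and y: "norm y \<le> 1" and xy: "2 - \<epsilon> \<le> norm (x + y)"
    and s: "0 \<le> s" and r: "0 \<le> r"
  shows "s + r - max s r * \<epsilon> \<le> norm (s *\<^sub>R x + r *\<^sub>R y)"
proof -
  have *: "b + a - b * \<epsilon> \<le> norm (b *\<^sub>R p + a *\<^sub>R q)"
    if "norm q \<le> 1" "2 - \<epsilon> \<le> norm (p + q)" "0 \<le> a" "a \<le> b" for a b and p q :: 'a
  proof -
    have "b *\<^sub>R (p + q) = (b *\<^sub>R p + a *\<^sub>R q) + (b - a) *\<^sub>R q" by (simp add: algebra_simps)
    then have "b * norm (p + q) \<le> norm (b *\<^sub>R p + a *\<^sub>R q) + (b - a) * norm q"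
      using norm_triangle_ineq[of "b *\<^sub>R p + a *\<^sub>R q" "(b - a) *\<^sub>R q"] that
      by (metis abs_of_nonneg diff_ge_0_iff_ge norm_scaleR order_trans)
    moreover have "b * (2 - \<epsilon>) \<le> b * norm (p + q)" using that by (intro mult_left_mono) auto
    moreover have "(b - a) * norm q \<le> (b - a) * 1" using that by (intro mult_left_mono) auto
    ultimately show ?thesis by (simp add: algebra_simps)
  qed
  show ?thesis
  proof (cases "r \<le> s")
    case True
    then show ?thesis using *[of y x r s] y xy r by (simp add: max_def algebra_simps)
  next
    case False
    then show ?thesis using *[of x y s r] x xy s by (simp add: max_def algebra_simps)
  qed
qed

lemma gurariy_slices_l1_orthogonal:
  assumes G: "gurariy_space TYPE('a::banach)"
  shows "slices_l1_orthogonal TYPE('a)"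
  unfolding slices_l1_orthogonal_def
proof (intro allI impI)
  fix f :: "'a \<Rightarrow>\<^sub>L real" and \<epsilon> r :: real and v :: 'a
  assume f: "norm f = 1" and e: "0 < \<epsilon>" and r: "0 \<le> r"
  obtain x :: 'a where x: "norm x = 1" "v = norm v *\<^sub>R x"
  proof (cases "v = 0")
    case True
    \<comment> \<open>The zero vector has no direction; any unit vector serves, and \<open>f \<noteq> 0\<close> provides one.\<close>
    obtain z where "z \<in> slice f 1" using slice_nonempty[OF f, of 1] by auto
    then have "z \<noteq> 0" by (auto simp: slice_def)
    then show ?thesis using that[of "sgn z"] True by (simp add: norm_sgn)
  next
    case False
    then show ?thesis using that[of "sgn v"] by (simp add: norm_sgn sgn_div_norm)
  qed
  define M where "M = 1 + max (norm v) r"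
  have M: "1 \<le> M" "max (norm v) r \<le> M" using r by (auto simp: M_def)
  obtain y where y: "y \<in> slice f (\<epsilon> / M)" "norm (x + y) > 2 - \<epsilon> / M"
    using gurariy_slice_far_point[OF G f x(1), of "\<epsilon> / M"] e M by auto
  have "norm v + r - max (norm v) r * (\<epsilon> / M) \<le> norm (norm v *\<^sub>R x + r *\<^sub>R y)"
    using x y r by (intro norm_add_scaled_ge) (auto simp: slice_def)
  moreover have "max (norm v) r * (\<epsilon> / M) \<le> M * (\<epsilon> / M)"
    using M e by (intro mult_right_mono) auto
  then have "max (norm v) r * (\<epsilon> / M) \<le> \<epsilon>" using M by simp
  ultimately have "norm v + r - \<epsilon> \<le> norm (v + r *\<^sub>R y)" using x(2) by simp
  moreover have "\<epsilon> / M \<le> \<epsilon>" using M e by (simp add: field_simps)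
  then have "y \<in> slice f \<epsilon>" using y(1) slice_mono by blast
  ultimately show "\<exists>y\<in>slice f \<epsilon>. norm v + r - \<epsilon> \<le> norm (v + r *\<^sub>R y)" by blast
qed

section \<open>The Daugavet property\<close>

text \<open>Moving the whole norm of the operator into \<open>u\<close> makes \<open>f\<close> a functional that defines
  slices.\<close>

lemma rank_one_blinfun_factorization:
  fixes T :: "'a::real_normed_vector \<Rightarrow>\<^sub>L 'b::real_normed_vector"
  assumes "dim (range (blinfun_apply T)) = 1"
  obtains f :: "'a \<Rightarrow>\<^sub>L real" and u
  where "norm f = 1" "norm u = norm T" "\<And>z. T z = f z *\<^sub>R u"
proof -
  obtain B where B: "independent B" "range (blinfun_apply T) \<subseteq> span B" "card B = 1"
      "B \<subseteq> range (blinfun_apply T)"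
    using basis_exists[of "range (blinfun_apply T)"] assms by metis
  from B(3) obtain b where b: "B = {b}" by (auto simp: card_1_singleton_iff)
  then have b0: "b \<noteq> 0" using B(1) by (auto simp: dependent_zero)
  then have "T \<noteq> 0" using B(4) b by auto
  then have T0: "norm T > 0" by simp
  define u where "u = norm T *\<^sub>R sgn b"
  have u: "norm u = norm T" "u \<noteq> 0" using b0 T0 by (auto simp: u_def norm_sgn sgn_zero_iff)
  have "\<exists>k. T z = k *\<^sub>R u" for z
  proof -
    obtain k where "T z = k *\<^sub>R b" using B(2) b by (auto simp: span_singleton)
    moreover have "b = (norm b / norm T) *\<^sub>R u"
      using b0 T0 by (simp add: u_def sgn_div_norm)
    ultimately show ?thesis by (metis scaleR_scaleR)
  qed
  then obtain k where k: "\<And>z. T z = k z *\<^sub>R u" by metis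
  have kn: "norm (k z) = norm (T z) / norm T" for z using k[of z] u T0 by simp
  have kz: "norm (k z) \<le> norm z" for z
    using norm_blinfun[of T z] T0 by (simp only: kn pos_divide_le_eq) (simp add: mult.commute)
  have "bounded_linear k"
  proof
    fix y z :: 'a and a :: real
    have "k (y + z) *\<^sub>R u = (k y + k z) *\<^sub>R u"
      using k by (metis blinfun.add_right scaleR_add_left)
    then show "k (y + z) = k y + k z" using u by simp
    have "k (a *\<^sub>R z) *\<^sub>R u = (a * k z) *\<^sub>R u"
      using k by (metis blinfun.scaleR_right scaleR_scaleR)
    then show "k (a *\<^sub>R z) = a *\<^sub>R k z" using u by simp
    have "norm (k z) \<le> norm z * 1" for z using kz by simp
    then show "\<exists>K. \<forall>z. norm (k z) \<le> norm z * K" by blast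
  qed
  then have fk: "blinfun_apply (Blinfun k) = k" by (rule bounded_linear_Blinfun_apply)
  have "norm (Blinfun k) \<le> 1"
    using kz by (intro norm_blinfun_bound) (auto simp: fk)
  moreover have "norm T \<le> norm (Blinfun k) * norm T"
  proof (rule norm_blinfun_bound)
    fix z
    have "norm (k z) \<le> norm (Blinfun k) * norm z" using norm_blinfun[of "Blinfun k" z] fk by simp
    then have "norm (T z) \<le> norm (Blinfun k) * norm z * norm T"
      using T0 by (simp only: kn pos_divide_le_eq)
    then show "norm (T z) \<le> norm (Blinfun k) * norm T * norm z" by (simp add: ac_simps)
  qed simp
  ultimately have "norm (Blinfun k) = 1" using T0 by simp
  then show ?thesis using that[of "Blinfun k" u] u k fk by simp
qed

lemma slices_l1_orthogonal_imp_daugavet: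
  assumes "slices_l1_orthogonal TYPE('a::banach)"
  shows "daugavet_property TYPE('a)"
  unfolding daugavet_property_def
proof (intro allI impI)
  fix T :: "'a \<Rightarrow>\<^sub>L 'a"
  assume "dim (range (blinfun_apply T)) = 1"
  then obtain f :: "'a \<Rightarrow>\<^sub>L real" and u where
    fu: "norm f = 1" "norm u = norm T" "\<And>z. T z = f z *\<^sub>R u"
    using rank_one_blinfun_factorization by blast
  have "1 + norm T \<le> norm (id_blinfun + T)"
  proof (rule field_le_epsilon)
    fix \<eta> :: real assume \<eta>: "\<eta> > 0"
    \<comment> \<open>One \<open>\<epsilon>\<close> is lost in the orthogonality of \<open>u\<close> and \<open>y\<close>, and \<open>\<epsilon> \<parallel>u\<parallel>\<close> in replacing
      \<open>f y\<close> by \<open>1\<close>.\<close>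
    define \<epsilon> where "\<epsilon> = \<eta> / (1 + norm T)"
    have pos: "1 + norm T > 0" by (simp add: add_pos_nonneg)
    have \<epsilon>: "\<epsilon> > 0" "\<epsilon> + \<epsilon> * norm T = \<eta>"
    proof -
      show "\<epsilon> > 0" using \<eta> pos by (simp add: \<epsilon>_def)
      have "\<epsilon> * (1 + norm T) = \<eta>" using pos by (simp add: \<epsilon>_def)
      then show "\<epsilon> + \<epsilon> * norm T = \<eta>" by (simp add: algebra_simps)
    qed
    obtain y where y: "y \<in> slice f \<epsilon>" "norm u + 1 - \<epsilon> \<le> norm (u + 1 *\<^sub>R y)"
      using assms fu(1) \<epsilon>(1) unfolding slices_l1_orthogonal_def by (meson zero_le_one)
    have y1: "norm y \<le> 1" and fy: "1 - \<epsilon> < f y" using y(1) by (auto simp: slice_def)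
    have "\<bar>f y\<bar> \<le> 1" using norm_blinfun[of f y] fu(1) y1 by simp
    then have fy1: "\<bar>1 - f y\<bar> \<le> \<epsilon>" using fy by linarith
    have "u + y = (id_blinfun + T) y + (1 - f y) *\<^sub>R u"
      by (simp add: blinfun.add_left fu(3) algebra_simps)
    then have "norm (u + y) \<le> norm ((id_blinfun + T) y) + \<bar>1 - f y\<bar> * norm u"
      using norm_triangle_ineq[of "(id_blinfun + T) y" "(1 - f y) *\<^sub>R u"] by simp
    moreover have "\<bar>1 - f y\<bar> * norm u \<le> \<epsilon> * norm u" using fy1 by (intro mult_right_mono) auto
    moreover have "norm ((id_blinfun + T) y) \<le> norm (id_blinfun + T)"
      using norm_blinfun[of "id_blinfun + T" y] y1
        mult_left_mono[OF y1, of "norm (id_blinfun + T)"] by simp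
    ultimately show "1 + norm T \<le> norm (id_blinfun + T) + \<eta>" using y(2) \<epsilon>(2) fu(2) by simp
  qed
  moreover have "norm (id_blinfun + T) \<le> 1 + norm T"
  proof (rule order_trans[OF norm_triangle_ineq])
    have "norm (id_blinfun :: 'a \<Rightarrow>\<^sub>L 'a) \<le> 1" by (intro norm_blinfun_bound) auto
    then show "norm (id_blinfun :: 'a \<Rightarrow>\<^sub>L 'a) + norm T \<le> 1 + norm T" by simp
  qed
  ultimately show "norm (id_blinfun + T) = 1 + norm T" by simp
qed

section \<open>The strong diameter 2 property\<close>

text \<open>The starting vector \<open>v\<close> allows two families of slices to be handled in succession.\<close>

lemma slices_l1_orthogonal_sum:
  fixes f :: "nat \<Rightarrow> 'a::banach \<Rightarrow>\<^sub>L real"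
  assumes L: "slices_l1_orthogonal TYPE('a)"
    and "\<And>i. i < n \<Longrightarrow> 0 \<le> l i \<and> norm (f i) = 1 \<and> 0 < \<epsilon> i" and "\<eta> > 0"
  shows "\<exists>z. (\<forall>i<n. z i \<in> slice (f i) (\<epsilon> i)) \<and>
           norm v + (\<Sum>i<n. l i) - \<eta> \<le> norm (v + (\<Sum>i<n. l i *\<^sub>R z i))"
  using assms(2,3)
proof (induction n arbitrary: \<eta>)
  case 0
  then show ?case by auto
next
  case (Suc n)
  have "\<exists>z. (\<forall>i<n. z i \<in> slice (f i) (\<epsilon> i)) \<and>
      norm v + (\<Sum>i<n. l i) - \<eta> / 2 \<le> norm (v + (\<Sum>i<n. l i *\<^sub>R z i))"
    by (rule Suc.IH) (use Suc.prems in auto)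
  then obtain z where z: "\<forall>i<n. z i \<in> slice (f i) (\<epsilon> i)"
      "norm v + (\<Sum>i<n. l i) - \<eta> / 2 \<le> norm (v + (\<Sum>i<n. l i *\<^sub>R z i))" by blast
  define w where "w = v + (\<Sum>i<n. l i *\<^sub>R z i)"
  define \<delta> where "\<delta> = min (\<epsilon> n) (\<eta> / 2)"
  have n: "0 \<le> l n" "norm (f n) = 1" "0 < \<delta>" using Suc.prems by (auto simp: \<delta>_def)
  obtain y where y: "y \<in> slice (f n) \<delta>" "norm w + l n - \<delta> \<le> norm (w + l n *\<^sub>R y)"
    using L n unfolding slices_l1_orthogonal_def by blast
  have "y \<in> slice (f n) (\<epsilon> n)" using y(1) slice_mono[of \<delta> "\<epsilon> n"] by (auto simp: \<delta>_def)
  then have "\<forall>i<Suc n. (z(n := y)) i \<in> slice (f i) (\<epsilon> i)" using z(1) by (auto simp: less_Suc_eq)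
  moreover have "norm v + (\<Sum>i<Suc n. l i) - \<eta> \<le> norm (w + l n *\<^sub>R y)"
  proof -
    have "\<delta> \<le> \<eta> / 2" by (simp add: \<delta>_def)
    then show ?thesis using y(2) z(2) unfolding w_def[symmetric] by simp
  qed
  moreover have "v + (\<Sum>i<Suc n. l i *\<^sub>R (z(n := y)) i) = w + l n *\<^sub>R y"
    by (simp add: w_def)
  ultimately show ?case by metis
qed

lemma slices_l1_orthogonal_imp_strong_diameter_2:
  assumes L: "slices_l1_orthogonal TYPE('a::banach)"
  shows "strong_diameter_2_property TYPE('a)"
  unfolding strong_diameter_2_property_def
proof (intro allI impI)
  fix C :: "'a set"
  assume "convex_comb_of_slices C"
  then obtain n and l \<epsilon> :: "nat \<Rightarrow> real" and f :: "nat \<Rightarrow> 'a \<Rightarrow>\<^sub>L real" where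
    lf: "\<And>i. i < n \<Longrightarrow> 0 \<le> l i \<and> norm (f i) = 1 \<and> 0 < \<epsilon> i" and l1: "(\<Sum>i<n. l i) = 1"
    and C: "C = {\<Sum>i<n. l i *\<^sub>R x i | x. \<forall>i<n. x i \<in> slice (f i) (\<epsilon> i)}"
    unfolding convex_comb_of_slices_def by blast
  have ball: "norm p \<le> 1" if p: "p \<in> C" for p
  proof -
    obtain x where x: "p = (\<Sum>i<n. l i *\<^sub>R x i)" "\<forall>i<n. x i \<in> slice (f i) (\<epsilon> i)"
      using p C by blast
    have "norm p \<le> (\<Sum>i<n. l i * 1)" unfolding x(1)
    proof (rule sum_norm_le)
      fix i assume "i \<in> {..<n}"
      then have "0 \<le> l i" "norm (x i) \<le> 1" using lf x(2) by (auto simp: slice_def)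
      then show "norm (l i *\<^sub>R x i) \<le> l i * 1" by (simp add: mult_left_le)
    qed
    then show ?thesis using l1 by simp
  qed
  then have bdd: "bounded C" by (auto simp: bounded_iff)
  have "diameter C \<le> 2"
  proof (rule diameter_le)
    fix p q assume "p \<in> C" "q \<in> C"
    then show "norm (p - q) \<le> 2" using ball[of p] ball[of q] norm_triangle_ineq4[of p q] by simp
  qed simp
  moreover have "2 \<le> diameter C"
  proof (rule field_le_epsilon)
    fix \<eta> :: real assume \<eta>: "\<eta> > 0"
    obtain x where x: "\<forall>i<n. x i \<in> slice (f i) (\<epsilon> i)"
        "norm (0::'a) + (\<Sum>i<n. l i) - \<eta> / 2 \<le> norm (0 + (\<Sum>i<n. l i *\<^sub>R x i))"
      using slices_l1_orthogonal_sum[where f = "f" and n = n and l = l and \<epsilon> = \<epsilon> and \<eta> = "\<eta> / 2" and v = 0,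
          OF L lf] \<eta> by auto
    define p where "p = (\<Sum>i<n. l i *\<^sub>R x i)"
    have nf: "0 \<le> l i \<and> norm (- f i) = 1 \<and> 0 < \<epsilon> i" if "i < n" for i using lf that by simp
    obtain z where z: "\<forall>i<n. z i \<in> slice (- f i) (\<epsilon> i)"
        "norm p + (\<Sum>i<n. l i) - \<eta> / 2 \<le> norm (p + (\<Sum>i<n. l i *\<^sub>R z i))"
      using slices_l1_orthogonal_sum[where f = "\<lambda>i. - f i" and n = n and l = l and \<epsilon> = \<epsilon> and \<eta> = "\<eta> / 2" and v = p,
          OF L nf] \<eta> by auto
    have "\<forall>i<n. - z i \<in> slice (f i) (\<epsilon> i)"
      using z(1) by (auto simp: slice_def blinfun.minus_left blinfun.minus_right)
    then have "(\<Sum>i<n. l i *\<^sub>R (- z i)) \<in> C"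
      unfolding C by (intro CollectI exI[of _ "\<lambda>i. - z i"]) simp
    moreover have "p \<in> C" using x(1) by (auto simp: C p_def)
    ultimately have "dist p (\<Sum>i<n. l i *\<^sub>R (- z i)) \<le> diameter C"
      using diameter_bounded_bound[OF bdd] by blast
    then have "norm (p + (\<Sum>i<n. l i *\<^sub>R z i)) \<le> diameter C"
      by (simp add: dist_norm sum_negf)
    then show "2 \<le> diameter C + \<eta>" using x(2) z(2) l1 by (simp add: p_def)
  qed
  ultimately show "diameter C = 2" by simp
qed

theorem corollary4p5:
  assumes "gurariy_space TYPE('a::banach)"
  shows "daugavet_property TYPE('a) \<and> strong_diameter_2_property TYPE('a)"
  using gurariy_slices_l1_orthogonal[OF assms] slices_l1_orthogonal_imp_daugavet
    slices_l1_orthogonal_imp_strong_diameter_2 by blast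

end
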